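(* Let $d\ge2$ and for $1\le i\le d$ let $K_i\subset\mathbb{R}$ be a compact set with convex hull $[A_i,B_i]$. If $$\sum_{i=1}^d\frac{\tau(K_i)}{\tau(K_i)+1}\ge1,$$ then $K_1+K_2+\cdots+K_d=\{\sum_{i=1}^dx_i:x_i\in K_i\}$ is a union of finitely many closed intervals.
   Context: Thickness. Let $K\subset\mathbb{R}$ be a compact set with convex hull $I$. The gaps of $K$ are the bounded connected components of $\mathbb{R}\setminus K$; they are enumerated as $(O_n)_{n\ge1}$ with non-increasing lengths $|O_n|$ (ties ordered arbitrarily). For each $n$, let $I_n$ be the connected component of $I\setminus(O_1\cup\cdots\cup O_{n-1})$ containing $O_n$, and let $L_n,R_n$ be the left and right closed intervals of $I_n\setminus O_n$ (called bridges). Then $$\tau(K)=\inf_{n}\frac{\min\{|L_n|,|R_n|\}}{|O_n|}.$$ It is always assumed, for sets whose thickness is considered, that there are infinitely many gaps and that there are no isolated points. *)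

theory Defs
  imports "HOL-Analysis.Analysis"
begin

definition gaps :: "real set \<Rightarrow> real set set" where
  "gaps K = {U \<in> components (- K). bounded U}"

abbreviation len :: "real set \<Rightarrow> real" where
  "len \<equiv> measure lborel"

text \<open>Enumerations start at index 0, and the order among gaps of equal length is free.\<close>
definition gap_enumeration :: "real set \<Rightarrow> (nat \<Rightarrow> real set) \<Rightarrow> bool" where
  "gap_enumeration K e \<longleftrightarrow>
     bij_betw e UNIV (gaps K) \<and> (\<forall>m n. m \<le> n \<longrightarrow> len (e n) \<le> len (e m))"

definition gap_component :: "real set \<Rightarrow> (nat \<Rightarrow> real set) \<Rightarrow> nat \<Rightarrow> real set" where
  "gap_component K e n =
     (THE C. C \<in> components (convex hull K - (\<Union>k<n. e k)) \<and> e n \<subseteq> C)"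

definition left_bridge :: "real set \<Rightarrow> (nat \<Rightarrow> real set) \<Rightarrow> nat \<Rightarrow> real set" where
  "left_bridge K e n = {x \<in> gap_component K e n - e n. \<forall>y\<in>e n. x \<le> y}"

definition right_bridge :: "real set \<Rightarrow> (nat \<Rightarrow> real set) \<Rightarrow> nat \<Rightarrow> real set" where
  "right_bridge K e n = {x \<in> gap_component K e n - e n. \<forall>y\<in>e n. y \<le> x}"

definition thickness_along :: "real set \<Rightarrow> (nat \<Rightarrow> real set) \<Rightarrow> real" where
  "thickness_along K e =
     (INF n. min (len (left_bridge K e n)) (len (right_bridge K e n)) / len (e n))"

text \<open>Meaningful when \<open>K\<close> is compact with infinitely many gaps; the choice of the enumeration
  is then possible and immaterial, see \<open>gap_enumeration_exists\<close> and \<open>thickness_eq\<close> below.\<close>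
definition thickness :: "real set \<Rightarrow> real" where
  "thickness K = thickness_along K (SOME e. gap_enumeration K e)"

lemma connected_component_real:
  fixes x y :: real
  shows "y \<in> connected_component_set S x \<longleftrightarrow> closed_segment x y \<subseteq> S"
proof
  assume "y \<in> connected_component_set S x"
  then obtain T where T: "connected T" "T \<subseteq> S" "x \<in> T" "y \<in> T"
    by (auto simp: connected_component_def)
  then have "convex T" by (metis is_interval_connected_1 is_interval_convex_1)
  then show "closed_segment x y \<subseteq> S" using T closed_segment_subset by blast
next
  assume "closed_segment x y \<subseteq> S"
  then show "y \<in> connected_component_set S x"
    unfolding mem_Collect_eq connected_component_def
    by (intro exI[of _ "closed_segment x y"]) auto
qed

lemma gap_interval:
  assumes "compact K" "U \<in> gaps K"
  obtains a b where "a < b" "U = {a<..<b}" "a \<in> K" "b \<in> K" "{a<..<b} \<inter> K = {}"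
proof -
  from assms have U: "U \<in> components (- K)" "bounded U" by (auto simp: gaps_def)
  then have con: "connected U" and ne: "U \<noteq> {}" and sub: "U \<subseteq> - K"
    using in_components_connected in_components_nonempty in_components_subset by blast+
  have op: "open U"
    using U(1) assms(1) open_components[of "- K" U] by (simp add: compact_imp_closed open_Compl)
  have bd: "bdd_above U" "bdd_below U"
    using U(2) bounded_imp_bdd_above bounded_imp_bdd_below by auto
  define a b where "a = Inf U" and "b = Sup U"
  have aU: "a \<notin> U"
  proof
    assume "a \<in> U"
    then obtain e where "e > 0" "ball a e \<subseteq> U" using op openE by blast
    then have "a - e/2 \<in> U" by (auto simp: dist_real_def subset_iff)
    then have "a \<le> a - e/2" using bd(2) cInf_lower unfolding a_def by blast
    with \<open>e > 0\<close> show False by simp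
  qed
  have bU: "b \<notin> U"
  proof
    assume "b \<in> U"
    then obtain e where "e > 0" "ball b e \<subseteq> U" using op openE by blast
    then have "b + e/2 \<in> U" by (auto simp: dist_real_def subset_iff)
    then have "b + e/2 \<le> b" using bd(1) cSup_upper unfolding b_def by blast
    with \<open>e > 0\<close> show False by simp
  qed
  have U_eq: "U = {a<..<b}"
  proof (intro set_eqI iffI)
    fix x assume "x \<in> U"
    then have "a \<le> x" "x \<le> b" using bd cInf_lower cSup_upper unfolding a_def b_def by auto
    moreover have "a \<noteq> x" "x \<noteq> b" using \<open>x \<in> U\<close> aU bU by auto
    ultimately show "x \<in> {a<..<b}" by auto
  next
    fix x assume "x \<in> {a<..<b}"
    then have "Inf U < x" "x < Sup U" by (auto simp: a_def b_def)
    then obtain y z where "y \<in> U" "y < x" "z \<in> U" "x < z"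
      using cInf_less_iff[OF ne bd(2)] less_cSup_iff[OF ne bd(1)] by blast
    then show "x \<in> U" using con connectedD_interval[of U y z x] by simp
  qed
  then have ab: "a < b" using ne by auto
  have max: "\<And>C. connected C \<Longrightarrow> C \<subseteq> - K \<Longrightarrow> C \<inter> U \<noteq> {} \<Longrightarrow> C \<subseteq> U"
    using components_maximal[OF U(1)] by blast
  have "a \<in> K"
  proof (rule ccontr)
    assume "a \<notin> K"
    moreover have eq: "{a..<b} = insert a U" using ab U_eq by auto
    ultimately have "{a..<b} \<subseteq> - K" using sub by simp
    moreover have "{a..<b} \<inter> U \<noteq> {}" using eq ne by blast
    ultimately have "{a..<b} \<subseteq> U" using max[of "{a..<b}"] by simp
    then show False using aU eq by blast
  qed
  moreover have "b \<in> K"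
  proof (rule ccontr)
    assume "b \<notin> K"
    moreover have eq: "{a<..b} = insert b U" using ab U_eq by auto
    ultimately have "{a<..b} \<subseteq> - K" using sub by simp
    moreover have "{a<..b} \<inter> U \<noteq> {}" using eq ne by blast
    ultimately have "{a<..b} \<subseteq> U" using max[of "{a<..b}"] by simp
    then show False using bU eq by blast
  qed
  ultimately show ?thesis using that ab U_eq sub by blast
qed

lemma gaps_disjoint: "U \<in> gaps K \<Longrightarrow> V \<in> gaps K \<Longrightarrow> U \<noteq> V \<Longrightarrow> U \<inter> V = {}"
  using components_nonoverlap unfolding gaps_def by blast

lemma finite_long_gaps:
  assumes "compact K" "0 < \<epsilon>"
  shows "finite {U \<in> gaps K. \<epsilon> \<le> len U}"
proof -
  obtain c where c: "\<And>x. x \<in> K \<Longrightarrow> \<bar>x\<bar> \<le> c"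
    using compact_imp_bounded[OF assms(1)] by (auto simp: bounded_real)
  define A B where "A = - \<bar>c\<bar>" and "B = \<bar>c\<bar>"
  have AB: "K \<subseteq> {A..B}" "A \<le> B" using c by (force simp: A_def B_def)+
  have "card F \<le> nat \<lceil>(B - A) / \<epsilon>\<rceil>"
    if F: "F \<subseteq> {U \<in> gaps K. \<epsilon> \<le> len U}" "finite F" for F
  proof -
    have U: "U \<in> sets lborel \<and> U \<subseteq> {A..B}" if "U \<in> F" for U
    proof -
      have "U \<in> gaps K" using that F by auto
      from gap_interval[OF assms(1) this] show ?thesis using AB(1)
        by (smt (verit) atLeastAtMost_iff greaterThanLessThan_iff sets_lborel
            borel_open open_greaterThanLessThan subset_iff)
    qed
    have fin: "emeasure lborel U \<noteq> \<infinity>" if "U \<in> F" for U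
    proof -
      have "emeasure lborel U \<le> emeasure lborel {A..B}"
        using U[OF that] by (intro emeasure_mono) auto
      also have "\<dots> < \<infinity>" using AB(2) by simp
      finally show ?thesis by simp
    qed
    have disj: "disjoint_family_on (\<lambda>U. U) F"
      using F gaps_disjoint unfolding disjoint_family_on_def by blast
    have "\<epsilon> * card F = (\<Sum>U\<in>F. \<epsilon>)" by simp
    also have "\<dots> \<le> (\<Sum>U\<in>F. len U)" using F by (intro sum_mono) auto
    also have "\<dots> = len (\<Union>U\<in>F. U)"
      using measure_finite_Union[of F "\<lambda>U. U" lborel] F(2) U fin disj
      by (simp add: subset_iff)
    also have "\<dots> \<le> len {A..B}"
      using U F(2) by (intro measure_mono_fmeasurable) (auto intro!: sets.finite_UN simp: fmeasurable_def emeasure_lborel_Icc[OF AB(2)])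
    also have "\<dots> = B - A" using AB by simp
    finally have "card F \<le> (B - A) / \<epsilon>" using assms(2) by (simp add: field_simps)
    then show ?thesis by linarith
  qed
  then show ?thesis using finite_if_finite_subsets_card_bdd by blast
qed

lemma len_gap_pos:
  assumes "compact K" "U \<in> gaps K"
  shows "0 < len U"
  using gap_interval[OF assms] by (metis diff_gt_0_iff_gt less_imp_le measure_lborel_Ioo)

lemma finite_has_argmax:
  fixes f :: "'a \<Rightarrow> real"
  assumes "finite A" "A \<noteq> {}"
  shows "\<exists>x\<in>A. \<forall>y\<in>A. f y \<le> f x"
proof -
  obtain x where "x \<in> A" "Max (f ` A) = f x" using obtains_MAX[OF assms] by metis
  then show ?thesis using assms(1) by (metis Max_ge finite_imageI imageI)
qed

lemma gap_enumeration_exists: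
  assumes "compact K" "infinite (gaps K)"
  shows "\<exists>e. gap_enumeration K e"
proof -
  define P where "P S U \<longleftrightarrow> U \<in> gaps K - S \<and> (\<forall>V\<in>gaps K - S. len V \<le> len U)" for S U
  have ex: "\<exists>U. P S U" if "finite S" for S
  proof -
    obtain U0 where U0: "U0 \<in> gaps K - S"
      using assms(2) \<open>finite S\<close> by (metis Diff_infinite_finite all_not_in_conv infinite_imp_nonempty)
    define F where "F = {U \<in> gaps K. len U0 \<le> len U} - S"
    have F: "finite F" "U0 \<in> F"
      using finite_long_gaps[OF assms(1) len_gap_pos[OF assms(1)]] U0 by (auto simp: F_def)
    then obtain U where U: "U \<in> F" "\<forall>V\<in>F. len V \<le> len U"
      using finite_has_argmax[of F len] by blast
    have "len V \<le> len U" if "V \<in> gaps K - S" for V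
    proof (cases "len U0 \<le> len V")
      case True
      then show ?thesis using U that by (auto simp: F_def)
    next
      case False
      then show ?thesis using U F by force
    qed
    then show ?thesis using U unfolding P_def F_def by blast
  qed
  define S where "S = rec_nat {} (\<lambda>_ T. insert (SOME U. P T U) T)"
  define e where "e n = (SOME U. P (S n) U)" for n
  have S0: "S 0 = {}" and SS: "\<And>n. S (Suc n) = insert (e n) (S n)"
    by (simp_all add: S_def e_def)
  have S: "S n = e ` {..<n}" for n by (induction n) (auto simp: S0 SS lessThan_Suc)
  have P: "P (e ` {..<n}) (e n)" for n
    using someI_ex[OF ex[of "S n"]] by (simp add: S[symmetric] e_def[symmetric]) (simp add: S)
  have eK: "e n \<in> gaps K" for n using P unfolding P_def by blast
  have "inj e"
  proof (rule linorder_injI)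
    fix m n :: nat assume "m < n"
    then have "e m \<in> e ` {..<n}" by simp
    moreover have "e n \<notin> e ` {..<n}" using P[of n] unfolding P_def by blast
    ultimately show "e m \<noteq> e n" by metis
  qed
  have mono: "len (e n) \<le> len (e m)" if "m \<le> n" for m n
  proof -
    have "e ` {..<m} \<subseteq> e ` {..<n}" using that by (intro image_mono) auto
    then have "e n \<in> gaps K - e ` {..<m}" using P[of n] unfolding P_def by blast
    then show ?thesis using P[of m] unfolding P_def by blast
  qed
  have "U \<in> range e" if "U \<in> gaps K" for U
  proof (rule ccontr)
    assume "U \<notin> range e"
    then have "U \<in> gaps K - e ` {..<n}" for n using that by blast
    then have "range e \<subseteq> {V \<in> gaps K. len U \<le> len V}"
      using P eK unfolding P_def by blast
    then have "finite (range e)"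
      using finite_long_gaps[OF assms(1) len_gap_pos[OF assms(1) that]] finite_subset by blast
    then show False using \<open>inj e\<close> finite_imageD by blast
  qed
  then have "bij_betw e UNIV (gaps K)" using \<open>inj e\<close> eK by (auto simp: bij_betw_def)
  then show ?thesis using mono unfolding gap_enumeration_def by blast
qed

lemma gap_component_eq:
  assumes "compact K" "gap_enumeration K e" "m \<in> e n"
  shows "gap_component K e n = {x. closed_segment m x \<subseteq> convex hull K - (\<Union>k<n. e k)}"
proof -
  let ?S = "convex hull K - (\<Union>k<n. e k)"
  have e: "e k \<in> gaps K" "inj e" for k
    using assms(2) unfolding gap_enumeration_def bij_betw_def by auto
  obtain a b where ab: "e n = {a<..<b}" "a \<in> K" "b \<in> K"
    using gap_interval[OF assms(1) e(1)[of n]] by metis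
  have "e n \<subseteq> closed_segment a b" using ab by (auto simp: closed_segment_eq_real_ivl)
  also have "\<dots> \<subseteq> convex hull K"
    using ab by (intro closed_segment_subset) (auto intro: hull_inc)
  finally have "e n \<subseteq> convex hull K" .
  moreover have "e k \<inter> e n = {}" if "k < n" for k
    using gaps_disjoint[OF e(1) e(1)] e(2) that by (metis injD less_irrefl)
  ultimately have "e n \<subseteq> ?S" by blast
  then have "e n \<subseteq> connected_component_set ?S m"
    using ab assms(3) by (intro connected_component_maximal) auto
  moreover have "connected_component_set ?S m \<in> components ?S"
    using \<open>e n \<subseteq> ?S\<close> assms(3) by (auto intro: componentsI)
  moreover have "\<And>C. C \<in> components ?S \<Longrightarrow> e n \<subseteq> C \<Longrightarrow> C = connected_component_set ?S m"
  proof -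
    fix C assume C: "C \<in> components ?S" "e n \<subseteq> C"
    then obtain z where "C = connected_component_set ?S z" unfolding components_def by blast
    then show "C = connected_component_set ?S m"
      using connected_component_eq[of m ?S z] C(2) assms(3) by auto
  qed
  ultimately have "gap_component K e n = connected_component_set ?S m"
    unfolding gap_component_def by (intro the_equality conjI; (elim conjE)?) assumption+
  then show ?thesis using connected_component_real[of _ ?S m] by (simp add: set_eq_iff)
qed

lemma left_bridge_eq:
  assumes "compact K" "gap_enumeration K e" "e n = {a<..<b}" "a < b"
  shows "left_bridge K e n = {x \<in> convex hull K. x \<le> a \<and> (\<forall>k<n. {x..a} \<inter> e k = {})}"
proof -
  have e: "e k \<in> gaps K" "inj e" for k
    using assms(2) unfolding gap_enumeration_def bij_betw_def by auto
  obtain a' b' where "a' < b'" "e n = {a'<..<b'}" "a' \<in> K" "b' \<in> K"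
    using gap_interval[OF assms(1) e(1)[of n]] by metis
  then have aK: "a \<in> K" "b \<in> K" using assms(3,4) by (auto simp: greaterThanLessThan_eq_iff)
  define m where "m = (a + b) / 2"
  have m: "m \<in> e n" "a < m" "m < b" using assms(3,4) by (auto simp: m_def)
  have disj: "e k \<inter> e n = {}" if "k < n" for k
    using gaps_disjoint[OF e(1) e(1)] e(2) that by (metis injD less_irrefl)
  have *: "(\<forall>y\<in>e n. x \<le> y) \<and> x \<notin> e n \<longleftrightarrow> x \<le> a" for x
  proof
    assume x: "(\<forall>y\<in>e n. x \<le> y) \<and> x \<notin> e n"
    show "x \<le> a"
    proof (rule ccontr)
      assume "\<not> x \<le> a"
      then have "(a + min x b) / 2 \<in> e n" "(a + min x b) / 2 < x" using assms(3,4) by auto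
      then show False using x by fastforce
    qed
  qed (use assms(3) in auto)
  have "closed_segment m x \<subseteq> convex hull K - (\<Union>k<n. e k)
      \<longleftrightarrow> x \<in> convex hull K \<and> (\<forall>k<n. {x..a} \<inter> e k = {})" if "x \<le> a" for x
  proof
    assume x: "closed_segment m x \<subseteq> convex hull K - (\<Union>k<n. e k)"
    moreover have "{x..a} \<subseteq> closed_segment m x" "x \<in> closed_segment m x"
      using that m by (auto simp: closed_segment_eq_real_ivl)
    ultimately show "x \<in> convex hull K \<and> (\<forall>k<n. {x..a} \<inter> e k = {})" by blast
  next
    assume x: "x \<in> convex hull K \<and> (\<forall>k<n. {x..a} \<inter> e k = {})"
    then have "closed_segment b x \<subseteq> convex hull K"
      using aK by (intro closed_segment_subset) (auto intro: hull_inc)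
    moreover have "closed_segment m x \<subseteq> closed_segment b x" "closed_segment m x \<subseteq> {x..a} \<union> e n"
      using that m assms(3) by (auto simp: closed_segment_eq_real_ivl)
    ultimately show "closed_segment m x \<subseteq> convex hull K - (\<Union>k<n. e k)"
      using x disj by blast
  qed
  note seg = this
  show ?thesis
    unfolding left_bridge_def gap_component_eq[OF assms(1,2) m(1)]
    by (intro set_eqI) (simp only: mem_Collect_eq Diff_iff, metis * seg)
qed

lemma right_bridge_eq:
  assumes "compact K" "gap_enumeration K e" "e n = {a<..<b}" "a < b"
  shows "right_bridge K e n = {x \<in> convex hull K. b \<le> x \<and> (\<forall>k<n. {b..x} \<inter> e k = {})}"
proof -
  have e: "e k \<in> gaps K" "inj e" for k
    using assms(2) unfolding gap_enumeration_def bij_betw_def by auto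
  obtain a' b' where "a' < b'" "e n = {a'<..<b'}" "a' \<in> K" "b' \<in> K"
    using gap_interval[OF assms(1) e(1)[of n]] by metis
  then have aK: "a \<in> K" "b \<in> K" using assms(3,4) by (auto simp: greaterThanLessThan_eq_iff)
  define m where "m = (a + b) / 2"
  have m: "m \<in> e n" "a < m" "m < b" using assms(3,4) by (auto simp: m_def)
  have disj: "e k \<inter> e n = {}" if "k < n" for k
    using gaps_disjoint[OF e(1) e(1)] e(2) that by (metis injD less_irrefl)
  have *: "(\<forall>y\<in>e n. y \<le> x) \<and> x \<notin> e n \<longleftrightarrow> b \<le> x" for x
  proof
    assume x: "(\<forall>y\<in>e n. y \<le> x) \<and> x \<notin> e n"
    show "b \<le> x"
    proof (rule ccontr)
      assume "\<not> b \<le> x"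
      then have "(b + max x a) / 2 \<in> e n" "x < (b + max x a) / 2" using assms(3,4) by auto
      then show False using x by fastforce
    qed
  qed (use assms(3) in auto)
  have "closed_segment m x \<subseteq> convex hull K - (\<Union>k<n. e k)
      \<longleftrightarrow> x \<in> convex hull K \<and> (\<forall>k<n. {b..x} \<inter> e k = {})" if "b \<le> x" for x
  proof
    assume x: "closed_segment m x \<subseteq> convex hull K - (\<Union>k<n. e k)"
    moreover have "{b..x} \<subseteq> closed_segment m x" "x \<in> closed_segment m x"
      using that m by (auto simp: closed_segment_eq_real_ivl)
    ultimately show "x \<in> convex hull K \<and> (\<forall>k<n. {b..x} \<inter> e k = {})" by blast
  next
    assume x: "x \<in> convex hull K \<and> (\<forall>k<n. {b..x} \<inter> e k = {})"
    then have "closed_segment a x \<subseteq> convex hull K"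
      using aK by (intro closed_segment_subset) (auto intro: hull_inc)
    moreover have "closed_segment m x \<subseteq> closed_segment a x" "closed_segment m x \<subseteq> {b..x} \<union> e n"
      using that m assms(3) by (auto simp: closed_segment_eq_real_ivl)
    ultimately show "closed_segment m x \<subseteq> convex hull K - (\<Union>k<n. e k)"
      using x disj by blast
  qed
  note seg = this
  show ?thesis
    unfolding right_bridge_def gap_component_eq[OF assms(1,2) m(1)]
    by (intro set_eqI) (simp only: mem_Collect_eq Diff_iff, metis * seg)
qed

lemma bridge_fmeasurable:
  assumes "compact K" "gap_enumeration K e"
  shows "left_bridge K e n \<in> fmeasurable lborel" "right_bridge K e n \<in> fmeasurable lborel"
proof -
  have e: "e n \<in> gaps K"
    using assms(2) unfolding gap_enumeration_def bij_betw_def by auto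
  obtain a b where ab: "a < b" "e n = {a<..<b}" using gap_interval[OF assms(1) e] by metis
  have I: "is_interval (convex hull K)" using is_interval_convex_1 by blast
  have bd: "bounded (convex hull K)" using assms(1) by (simp add: compact_convex_hull compact_imp_bounded)
  have "is_interval (left_bridge K e n)"
    unfolding left_bridge_eq[OF assms ab(2,1)] is_interval_1
  proof (intro allI ballI impI)
    fix x z y
    assume x: "x \<in> {x \<in> convex hull K. x \<le> a \<and> (\<forall>k<n. {x..a} \<inter> e k = {})}"
      and z: "z \<in> {x \<in> convex hull K. x \<le> a \<and> (\<forall>k<n. {x..a} \<inter> e k = {})}"
      and y: "x \<le> y \<and> y \<le> z"
    have "{y..a} \<subseteq> {x..a}" "y \<le> a" using y z by auto
    moreover have "y \<in> convex hull K" using I x y z unfolding is_interval_1 by blast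
    ultimately show "y \<in> {x \<in> convex hull K. x \<le> a \<and> (\<forall>k<n. {x..a} \<inter> e k = {})}"
      using x z by blast
  qed
  moreover have "is_interval (right_bridge K e n)"
    unfolding right_bridge_eq[OF assms ab(2,1)] is_interval_1
  proof (intro allI ballI impI)
    fix x z y
    assume x: "x \<in> {x \<in> convex hull K. b \<le> x \<and> (\<forall>k<n. {b..x} \<inter> e k = {})}"
      and z: "z \<in> {x \<in> convex hull K. b \<le> x \<and> (\<forall>k<n. {b..x} \<inter> e k = {})}"
      and y: "x \<le> y \<and> y \<le> z"
    have "{b..y} \<subseteq> {b..z}" "b \<le> y" using x y by auto
    moreover have "y \<in> convex hull K" using I x y z unfolding is_interval_1 by blast
    ultimately show "y \<in> {x \<in> convex hull K. b \<le> x \<and> (\<forall>k<n. {b..x} \<inter> e k = {})}"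
      using x z by blast
  qed
  moreover have "left_bridge K e n \<subseteq> convex hull K" "right_bridge K e n \<subseteq> convex hull K"
    using left_bridge_eq[OF assms ab(2,1)] right_bridge_eq[OF assms ab(2,1)] by auto
  moreover have "X \<in> fmeasurable lborel" if "is_interval X" "X \<subseteq> convex hull K" for X :: "real set"
  proof -
    have "X \<in> sets borel" using that(1) by (simp add: real_interval_borel_measurable)
    moreover have "bounded X" using bd that(2) bounded_subset by blast
    ultimately show ?thesis
      by (intro fmeasurableI) (use emeasure_bounded_finite[of X] in \<open>auto simp: infinity_ennreal_def\<close>)
  qed
  ultimately show "left_bridge K e n \<in> fmeasurable lborel" "right_bridge K e n \<in> fmeasurable lborel"
    by auto
qed

lemma thickness_along_le:
  "thickness_along K e \<le> min (len (left_bridge K e n)) (len (right_bridge K e n)) / len (e n)"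
  unfolding thickness_along_def
  by (rule cINF_lower) (auto intro!: bdd_belowI[of _ 0])

lemma thickness_along_mono:
  assumes "compact K" "gap_enumeration K e" "gap_enumeration K e'"
  shows "thickness_along K e \<le> thickness_along K e'"
proof -
  let ?t = "thickness_along K e"
  have e: "e k \<in> gaps K" "inj e" "range e = gaps K" "\<And>m n. m \<le> n \<Longrightarrow> len (e n) \<le> len (e m)" for k
    using assms(2) unfolding gap_enumeration_def bij_betw_def by auto
  have e': "e' k \<in> gaps K" "inj e'" "range e' = gaps K" "\<And>m n. m \<le> n \<Longrightarrow> len (e' n) \<le> len (e' m)" for k
    using assms(3) unfolding gap_enumeration_def bij_betw_def by auto
  have t: "?t * len (e n) \<le> len (left_bridge K e n)" "?t * len (e n) \<le> len (right_bridge K e n)" for n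
    using thickness_along_le[of K e n] len_gap_pos[OF assms(1) e(1)[of n]]
    by (auto simp: pos_le_divide_eq)
  have main: "?t * len (e' m) \<le> len (left_bridge K e' m) \<and> ?t * len (e' m) \<le> len (right_bridge K e' m)" for m
  proof -
    obtain n where n: "e n = e' m" using e(3) e'(1)[of m] by (metis imageE)
    obtain a b where ab: "a < b" "e' m = {a<..<b}" "a \<in> K" "b \<in> K" "{a<..<b} \<inter> K = {}"
      using gap_interval[OF assms(1) e'(1)[of m]] by metis
    have nab: "e n = {a<..<b}" using ab n by simp
    note L = left_bridge_eq[OF assms(1,2) nab ab(1)] and R = right_bridge_eq[OF assms(1,2) nab ab(1)]
    note L' = left_bridge_eq[OF assms(1,3) ab(2,1)] and R' = right_bridge_eq[OF assms(1,3) ab(2,1)]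
    have earlier: "\<exists>j>n. e j = e' k \<and> len (e j) = len (e' m)"
      if "k < m" "\<forall>i<n. e' k \<noteq> e i" for k
    proof -
      obtain j where j: "e j = e' k" using e(3) e'(1)[of k] by (metis imageE)
      have "j \<noteq> n" using j n e'(2) that(1) by (metis injD less_irrefl)
      then have "n < j" using that j by (metis linorder_neqE_nat)
      then have "len (e j) \<le> len (e n)" "len (e' m) \<le> len (e' k)" using e(4) e'(4) that by auto
      then show ?thesis using \<open>n < j\<close> j n by force
    qed
    have ends: "\<exists>c d. c < d \<and> e' k = {c<..<d} \<and> c \<in> K \<and> d \<in> K \<and> (d \<le> a \<or> b \<le> c)" if "k < m" for k
    proof -
      obtain c d where cd: "c < d" "e' k = {c<..<d}" "c \<in> K" "d \<in> K" "{c<..<d} \<inter> K = {}"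
        using gap_interval[OF assms(1) e'(1)[of k]] by metis
      have "e' k \<inter> e' m = {}" using gaps_disjoint[OF e'(1) e'(1)] e'(2) that by (metis injD less_irrefl)
      then have "\<not> max a c < min b d"
        using cd(2) ab(2) dense[of "max a c" "min b d"] by auto
      then have "d \<le> a \<or> b \<le> c" using cd(1) ab(1) by linarith
      then show ?thesis using cd by blast
    qed
    have "?t * len (e' m) \<le> len (left_bridge K e' m)"
    proof (cases "left_bridge K e n \<subseteq> left_bridge K e' m")
      case True
      then have "len (left_bridge K e n) \<le> len (left_bridge K e' m)"
        by (intro measure_mono_fmeasurable fmeasurableD bridge_fmeasurable[OF assms(1,2)]
            bridge_fmeasurable[OF assms(1,3)])
      then show ?thesis using t(1)[of n] n by simp
    next
      case False
      then obtain x where x: "x \<in> convex hull K" "x \<le> a" "\<forall>k<n. {x..a} \<inter> e k = {}"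
          "\<exists>k<m. {x..a} \<inter> e' k \<noteq> {}" unfolding L L' by blast
      define M where "M = {k. k < m \<and> {x..a} \<inter> e' k \<noteq> {}}"
      define g where "g k = Sup (e' k)" for k
      have M: "finite M" "M \<noteq> {}" using x(4) by (auto simp: M_def)
      obtain k where k: "k \<in> M" "\<And>i. i \<in> M \<Longrightarrow> g i \<le> g k"
        using finite_has_argmax[OF M, of g] by blast
      then have km: "k < m" "{x..a} \<inter> e' k \<noteq> {}" by (auto simp: M_def)
      obtain c d where cd: "c < d" "e' k = {c<..<d}" "c \<in> K" "d \<in> K" "d \<le> a \<or> b \<le> c"
        using ends[OF km(1)] by blast
      have da: "d \<le> a" and xd: "x \<le> d" using cd km(2) ab(1) by auto
      obtain j where j: "j > n" "e j = e' k" "len (e j) = len (e' m)"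
        using earlier[OF km(1)] km(2) x(3) by metis
      have "right_bridge K e j \<subseteq> {d..a}"
      proof
        fix y assume "y \<in> right_bridge K e j"
        then have y: "d \<le> y" "{d..y} \<inter> e n = {}"
          using right_bridge_eq[OF assms(1,2), of j c d] cd j by auto
        have "y \<le> a"
        proof (rule ccontr)
          assume "\<not> y \<le> a"
          then obtain z where "a < z" "z < min y b" using ab(1) dense[of a "min y b"] by auto
          then have "z \<in> {d..y} \<inter> e n" using nab da by auto
          then show False using y by blast
        qed
        then show "y \<in> {d..a}" using y by simp
      qed
      moreover have "{d..a} \<subseteq> left_bridge K e' m"
      proof
        fix y assume y: "y \<in> {d..a}"
        have "closed_segment d a \<subseteq> convex hull K"
          using ab cd by (intro closed_segment_subset) (auto intro: hull_inc)
        then have "y \<in> convex hull K" using y by (auto simp: closed_segment_eq_real_ivl)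
        moreover have "{y..a} \<inter> e' i = {}" if im: "i < m" for i
        proof (rule ccontr)
          assume *: "{y..a} \<inter> e' i \<noteq> {}"
          moreover have "{y..a} \<subseteq> {x..a}" using y xd by auto
          ultimately have "i \<in> M" using im unfolding M_def by blast
          then have "g i \<le> g k" using k by blast
          moreover obtain p q where pq: "p < q" "e' i = {p<..<q}" using ends[OF im] by blast
          ultimately have "q \<le> d" using cd by (simp add: g_def)
          then show False using * pq y by auto
        qed
        ultimately show "y \<in> left_bridge K e' m" unfolding L' using y by auto
      qed
      ultimately have "len (right_bridge K e j) \<le> len (left_bridge K e' m)"
        by (intro measure_mono_fmeasurable fmeasurableD bridge_fmeasurable[OF assms(1,2)]
            bridge_fmeasurable[OF assms(1,3)]) auto
      then show ?thesis using t(2)[of j] j by simp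
    qed
    moreover have "?t * len (e' m) \<le> len (right_bridge K e' m)"
    proof (cases "right_bridge K e n \<subseteq> right_bridge K e' m")
      case True
      then have "len (right_bridge K e n) \<le> len (right_bridge K e' m)"
        by (intro measure_mono_fmeasurable fmeasurableD bridge_fmeasurable[OF assms(1,2)]
            bridge_fmeasurable[OF assms(1,3)])
      then show ?thesis using t(2)[of n] n by simp
    next
      case False
      then obtain x where x: "x \<in> convex hull K" "b \<le> x" "\<forall>k<n. {b..x} \<inter> e k = {}"
          "\<exists>k<m. {b..x} \<inter> e' k \<noteq> {}" unfolding R R' by blast
      define M where "M = {k. k < m \<and> {b..x} \<inter> e' k \<noteq> {}}"
      define g where "g k = - Inf (e' k)" for k
      have M: "finite M" "M \<noteq> {}" using x(4) by (auto simp: M_def)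
      obtain k where k: "k \<in> M" "\<And>i. i \<in> M \<Longrightarrow> g i \<le> g k"
        using finite_has_argmax[OF M, of g] by blast
      then have km: "k < m" "{b..x} \<inter> e' k \<noteq> {}" by (auto simp: M_def)
      obtain c d where cd: "c < d" "e' k = {c<..<d}" "c \<in> K" "d \<in> K" "d \<le> a \<or> b \<le> c"
        using ends[OF km(1)] by blast
      have bc: "b \<le> c" and cx: "c \<le> x" using cd km(2) ab(1) by auto
      obtain j where j: "j > n" "e j = e' k" "len (e j) = len (e' m)"
        using earlier[OF km(1)] km(2) x(3) by metis
      have "left_bridge K e j \<subseteq> {b..c}"
      proof
        fix y assume "y \<in> left_bridge K e j"
        then have y: "y \<le> c" "{y..c} \<inter> e n = {}"
          using left_bridge_eq[OF assms(1,2), of j c d] cd j by auto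
        have "b \<le> y"
        proof (rule ccontr)
          assume "\<not> b \<le> y"
          then obtain z where "max y a < z" "z < b" using ab(1) dense[of "max y a" b] by auto
          then have "z \<in> {y..c} \<inter> e n" using nab bc by auto
          then show False using y by blast
        qed
        then show "y \<in> {b..c}" using y by simp
      qed
      moreover have "{b..c} \<subseteq> right_bridge K e' m"
      proof
        fix y assume y: "y \<in> {b..c}"
        have "closed_segment b c \<subseteq> convex hull K"
          using ab cd by (intro closed_segment_subset) (auto intro: hull_inc)
        then have "y \<in> convex hull K" using y by (auto simp: closed_segment_eq_real_ivl)
        moreover have "{b..y} \<inter> e' i = {}" if im: "i < m" for i
        proof (rule ccontr)
          assume *: "{b..y} \<inter> e' i \<noteq> {}"
          moreover have "{b..y} \<subseteq> {b..x}" using y cx by auto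
          ultimately have "i \<in> M" using im unfolding M_def by blast
          then have "g i \<le> g k" using k by blast
          moreover obtain p q where pq: "p < q" "e' i = {p<..<q}" using ends[OF im] by blast
          ultimately have "c \<le> p" using cd by (simp add: g_def)
          then show False using * pq y by auto
        qed
        ultimately show "y \<in> right_bridge K e' m" unfolding R' using y by auto
      qed
      ultimately have "len (left_bridge K e j) \<le> len (right_bridge K e' m)"
        by (intro measure_mono_fmeasurable fmeasurableD bridge_fmeasurable[OF assms(1,2)]
            bridge_fmeasurable[OF assms(1,3)]) auto
      then show ?thesis using t(1)[of j] j by simp
    qed
    ultimately show ?thesis by blast
  qed
  show ?thesis
    unfolding thickness_along_def[of K e']
    using main len_gap_pos[OF assms(1) e'(1)] by (intro cINF_greatest) (auto simp: pos_le_divide_eq)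
qed

lemma thickness_eq:
  assumes "compact K" "gap_enumeration K e"
  shows "thickness K = thickness_along K e"
  using thickness_along_mono[OF assms(1)] assms(2) someI[of "gap_enumeration K" e]
  unfolding thickness_def by (metis order_antisym)

end

theory Submission
  imports Defs
begin

text \<open>
  Write \<open>\<tau>\<^sub>i\<close> for the thickness of \<open>K\<^sub>i\<close> and \<open>\<gamma>\<^sub>i = \<tau>\<^sub>i / (\<tau>\<^sub>i + 1)\<close>, and measure a gap \<open>U\<close> of \<open>K\<^sub>i\<close> by its
  weighted length \<open>(\<tau>\<^sub>i + 1) |U|\<close>. A gap of weighted length \<open>H\<close> then has length \<open>(1 - \<gamma>\<^sub>i) H\<close>, and
  the interval left over next to it, before any gap at least as long, has length at
  least \<open>\<tau>\<^sub>i |U| = \<gamma>\<^sub>i H\<close>. In this normalisation the hypothesis \<open>\<Sum> \<gamma>\<^sub>i \<ge> 1\<close> reads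
  \<open>1 - \<gamma>\<^sub>k \<le> \<Sum> \<gamma>\<^sub>i\<close>, the sum over \<open>i \<noteq> k\<close>, and so it compares a gap of one set with the bridges of
  the others.

  Suppose that in each \<open>K\<^sub>i\<close> an interval \<open>J\<^sub>i\<close> is given whose ends are points of \<open>K\<^sub>i\<close>, which has length
  at least \<open>\<gamma>\<^sub>i H\<close>, all of whose gaps have weighted length at most \<open>H\<close>, and beyond each of whose ends
  \<open>K\<^sub>i\<close> is empty for a length \<open>H / (\<tau>\<^sub>i + 1)\<close> (a \<open>piece\<close>). The sum of the sets \<open>K\<^sub>i \<inter> J\<^sub>i\<close> is then the whole
  interval \<open>\<Sum> J\<^sub>i\<close>. Indeed, let \<open>U\<close> be a gap of largest weighted length \<open>H'\<close> in any of the pieces,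
  say in \<open>J\<^sub>k\<close>, and let it cut \<open>J\<^sub>k\<close> into \<open>L\<close> and \<open>R\<close>. Since
  \<open>|U| = (1 - \<gamma>\<^sub>k) H' \<le> \<Sum> \<gamma>\<^sub>i H' \<le> \<Sum> |J\<^sub>i|\<close>, with sums over \<open>i \<noteq> k\<close>, the intervals
  obtained from \<open>\<Sum> J\<^sub>i\<close> on replacing \<open>J\<^sub>k\<close> by \<open>L\<close> or by \<open>R\<close> still cover it. Both choices give pieces
  again, now at scale \<open>H'\<close>: the lengths of \<open>L\<close> and \<open>R\<close> are at least \<open>\<tau>\<^sub>k |U| = \<gamma>\<^sub>k H'\<close>, and the bounds for the
  other \<open>J\<^sub>i\<close> only get weaker. So a given target can be followed down until all gaps that remain are
  short (\<open>approx_sum_of_pieces\<close>), and compactness turns the approximation into an equality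
  (\<open>sum_of_pieces_eq_interval\<close>).

  It remains to cut each \<open>K\<^sub>i\<close> into finitely many pieces at one common scale \<open>\<epsilon>\<close>
  (\<open>finite_pieces\<close>, \<open>piece_containing\<close>): remove all gaps of weighted length at least \<open>\<epsilon>\<close>, of which there
  are finitely many. What lies between is long enough by the definition of thickness, and if nothing
  was removed it is the hull, which is long enough once \<open>\<epsilon>\<close> is at most the length of each hull. Every
  choice of one piece from each \<open>K\<^sub>i\<close> contributes one interval to the sum, of length at least
  \<open>\<Sum> \<gamma>\<^sub>i \<epsilon> \<ge> \<epsilon> > 0\<close>.
\<close>

section \<open>Gaps and their end points\<close>

text \<open>Gaps are recorded by their end points, so that the combinatorics below takes place among points
  of \<open>K\<close>.\<close>
definition gap_ends :: "real set \<Rightarrow> (real \<times> real) set" where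
  "gap_ends K = {(a, b). a < b \<and> a \<in> K \<and> b \<in> K \<and> {a<..<b} \<inter> K = {}}"

lemma gap_ends_imp_gap:
  assumes "(a, b) \<in> gap_ends K"
  shows "{a<..<b} \<in> gaps K"
proof -
  have ab: "a < b" "a \<in> K" "b \<in> K" "{a<..<b} \<inter> K = {}"
    using assms by (auto simp: gap_ends_def)
  have "{a<..<b} \<in> components (- K)"
    unfolding in_components_maximal
  proof (intro conjI allI impI)
    show "{a<..<b} \<noteq> {}" "{a<..<b} \<subseteq> - K" "connected {a<..<b}"
      using ab by auto
    fix C assume C: "C \<noteq> {} \<and> {a<..<b} \<subseteq> C \<and> C \<subseteq> - K \<and> connected C"
    define m where "m = (a + b) / 2"
    have m: "a < m" "m < b" using ab(1) by (auto simp: m_def)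
    then have mC: "m \<in> C" using C by auto
    have "a < x \<and> x < b" if "x \<in> C" for x
    proof (rule ccontr)
      assume "\<not> (a < x \<and> x < b)"
      then consider "x \<le> a" | "b \<le> x" by linarith
      then have "a \<in> C \<or> b \<in> C"
        by cases (use C m mC that connectedD_interval[of C x m a] connectedD_interval[of C m x b]
          in auto)
      then show False using C ab by blast
    qed
    then show "C = {a<..<b}" using C by auto
  qed
  then show ?thesis by (simp add: gaps_def)
qed

lemma finite_long_gap_ends:
  assumes "compact K" "0 < \<eta>"
  shows "finite {(a, b) \<in> gap_ends K. \<eta> \<le> b - a}"
proof (rule inj_on_finite)
  show "finite {U \<in> gaps K. \<eta> \<le> len U}" by (rule finite_long_gaps[OF assms])
  show "inj_on (\<lambda>(a, b). {a<..<b}) {(a, b) \<in> gap_ends K. \<eta> \<le> b - a}"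
    by (auto simp: inj_on_def gap_ends_def greaterThanLessThan_eq_iff)
  show "(\<lambda>(a, b). {a<..<b}) ` {(a, b) \<in> gap_ends K. \<eta> \<le> b - a} \<subseteq> {U \<in> gaps K. \<eta> \<le> len U}"
    using gap_ends_imp_gap by (auto simp: gap_ends_def)
qed

text \<open>Emptiness of \<open>K\<close> just beyond \<open>q\<close> is the form in which "a gap of length at least \<open>\<eta>\<close> starts at
  \<open>q\<close>" is carried through the argument, because it also holds at the right end of \<open>K\<close> and so spares a case
  distinction. This lemma and its mirror image recover the gap when \<open>K\<close> continues.\<close>
lemma gap_starting_at:
  assumes "compact K" "q \<in> K" "y \<in> K" "q < y" "0 < \<eta>" "{q<..<q + \<eta>} \<inter> K = {}"
  obtains b where "(q, b) \<in> gap_ends K" "\<eta> \<le> b - q" "b \<le> y"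
proof -
  define Y where "Y = K \<inter> {q + \<eta>..y}"
  have yge: "q + \<eta> \<le> y" using assms by (meson disjoint_iff greaterThanLessThan_iff not_le)
  have "compact Y" unfolding Y_def using assms(1) by (simp add: compact_Int)
  moreover have "Y \<noteq> {}" using yge assms by (auto simp: Y_def)
  ultimately obtain b where b: "b \<in> Y" "\<And>z. z \<in> Y \<Longrightarrow> b \<le> z"
    using compact_attains_inf[of Y] by metis
  have "{q<..<b} \<inter> K = {}"
  proof -
    have False if "q < z" "z < b" "z \<in> K" for z
    proof -
      have "q + \<eta> \<le> z" using that assms(6) by (meson disjoint_iff greaterThanLessThan_iff not_le)
      then have "z \<in> Y" using that b(1) by (auto simp: Y_def)
      then show False using b(2) that(2) by force
    qed
    then show ?thesis by auto
  qed
  then show ?thesis using that[of b] b(1) assms by (auto simp: gap_ends_def Y_def)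
qed

lemma gap_ending_at:
  assumes "compact K" "p \<in> K" "y \<in> K" "y < p" "0 < \<eta>" "{p - \<eta><..<p} \<inter> K = {}"
  obtains c where "(c, p) \<in> gap_ends K" "\<eta> \<le> p - c" "y \<le> c"
proof -
  define Y where "Y = K \<inter> {y..p - \<eta>}"
  have yge: "y \<le> p - \<eta>" using assms by (meson disjoint_iff greaterThanLessThan_iff not_le)
  have "compact Y" unfolding Y_def using assms(1) by (simp add: compact_Int)
  moreover have "Y \<noteq> {}" using yge assms by (auto simp: Y_def)
  ultimately obtain c where c: "c \<in> Y" "\<And>z. z \<in> Y \<Longrightarrow> z \<le> c"
    using compact_attains_sup[of Y] by metis
  have "{c<..<p} \<inter> K = {}"
  proof -
    have False if "c < z" "z < p" "z \<in> K" for z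
    proof -
      have "z \<le> p - \<eta>" using that assms(6) by (meson disjoint_iff greaterThanLessThan_iff not_le)
      then have "z \<in> Y" using that c(1) by (auto simp: Y_def)
      then show False using c(2) that(1) by force
    qed
    then show ?thesis by auto
  qed
  then show ?thesis using that[of c] c(1) assms by (auto simp: gap_ends_def Y_def)
qed

section \<open>Thickness without enumerations\<close>

text \<open>A lower bound \<open>t\<close> for the thickness, in a form that mentions neither an enumeration of the gaps
  nor how ties are broken: two gaps of length at least \<open>\<eta>\<close> are at least \<open>t * \<eta>\<close> apart. The unbounded
  components of the complement take part as gaps of infinite length; the last premise excludes
  that both gaps are unbounded.\<close>
definition thick :: "real set \<Rightarrow> real \<Rightarrow> bool" where
  "thick K t \<longleftrightarrow> (\<forall>p\<in>K. \<forall>q\<in>K. \<forall>\<eta>>0. p \<le> q \<longrightarrow> {p - \<eta><..<p} \<inter> K = {} \<longrightarrow>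
     {q<..<q + \<eta>} \<inter> K = {} \<longrightarrow> \<not> K \<subseteq> {p..q} \<longrightarrow> t * \<eta> \<le> q - p)"

lemma thickness_nonneg:
  "0 \<le> thickness K"
  unfolding thickness_def thickness_along_def by (rule cINF_greatest) simp_all

text \<open>This bounds the distance from \<open>a\<close> to any point that the bridge cannot pass; the point is going to
  be the end of an earlier gap, or of \<open>K\<close>.\<close>
lemma left_bridge_bound:
  assumes "compact K" "gap_enumeration K e" "e n = {a<..<b}" "a < b"
    and "\<And>x. x \<in> left_bridge K e n \<Longrightarrow> p \<le> x" "p \<le> a"
  shows "thickness K * (b - a) \<le> a - p"
proof -
  have "left_bridge K e n \<subseteq> {p..a}"
    using assms(5) left_bridge_eq[OF assms(1-4)] by auto
  then have "len (left_bridge K e n) \<le> len {p..a}"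
    using bridge_fmeasurable[OF assms(1,2)]
    by (intro measure_mono_fmeasurable fmeasurableD)
       (auto simp: fmeasurable_cbox(1)[where 'a = real, unfolded cbox_interval])
  moreover have "thickness K * (b - a) \<le> len (left_bridge K e n)"
    using thickness_along_le[of K e n] assms(3,4)
    by (simp add: thickness_eq[OF assms(1,2)] pos_le_divide_eq)
  ultimately show ?thesis using assms(6) by simp
qed

lemma right_bridge_bound:
  assumes "compact K" "gap_enumeration K e" "e n = {a<..<b}" "a < b"
    and "\<And>x. x \<in> right_bridge K e n \<Longrightarrow> x \<le> q" "b \<le> q"
  shows "thickness K * (b - a) \<le> q - b"
proof -
  have "right_bridge K e n \<subseteq> {b..q}"
    using assms(5) right_bridge_eq[OF assms(1-4)] by auto
  then have "len (right_bridge K e n) \<le> len {b..q}"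
    using bridge_fmeasurable[OF assms(1,2)]
    by (intro measure_mono_fmeasurable fmeasurableD)
       (auto simp: fmeasurable_cbox(1)[where 'a = real, unfolded cbox_interval])
  moreover have "thickness K * (b - a) \<le> len (right_bridge K e n)"
    using thickness_along_le[of K e n] assms(3,4)
    by (simp add: thickness_eq[OF assms(1,2)] pos_le_divide_eq)
  ultimately show ?thesis using assms(6) by simp
qed

text \<open>Of the two gaps around \<open>{p..q}\<close>, the one that comes later in the enumeration has a bridge which the
  earlier one stops, so that this bridge lies in \<open>{p..q}\<close>; its length is at least the thickness times the
  length of its own gap, hence times \<open>\<eta>\<close>. No comparison of the two gap lengths enters, and this is why
  the tie-breaking is irrelevant. If one of the gaps is unbounded, the bridge of the other ends with
  the hull.\<close>
lemma thick_thickness: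
  assumes "compact K" "infinite (gaps K)"
  shows "thick K (thickness K)"
  unfolding thick_def
proof (intro ballI allI impI)
  fix p q \<eta> :: real
  assume pq: "p \<in> K" "q \<in> K" "p \<le> q" and \<eta>: "0 < \<eta>"
    and ep: "{p - \<eta><..<p} \<inter> K = {}" and eq: "{q<..<q + \<eta>} \<inter> K = {}"
    and nsub: "\<not> K \<subseteq> {p..q}"
  obtain e where e: "gap_enumeration K e" using gap_enumeration_exists[OF assms] by blast
  have en: "\<exists>n. e n = {a<..<b}" if "(a, b) \<in> gap_ends K" for a b
    using gap_ends_imp_gap[OF that] e unfolding gap_enumeration_def bij_betw_def by (metis imageE)
  have scale: "thickness K * \<eta> \<le> thickness K * l" if "\<eta> \<le> l" for l
    using that thickness_nonneg by (intro mult_left_mono)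
  have left: "thickness K * \<eta> \<le> q - p"
    if n: "e n = {q<..<b}" "(q, b) \<in> gap_ends K" "\<eta> \<le> b - q"
      and lo: "\<And>x. x \<in> left_bridge K e n \<Longrightarrow> p \<le> x" for n b
    using left_bridge_bound[OF assms(1) e n(1) _ lo pq(3)] scale[OF n(3)] n(2)
    by (auto simp: gap_ends_def)
  have right: "thickness K * \<eta> \<le> q - p"
    if n: "e n = {c<..<p}" "(c, p) \<in> gap_ends K" "\<eta> \<le> p - c"
      and hi: "\<And>x. x \<in> right_bridge K e n \<Longrightarrow> x \<le> q" for n c
    using right_bridge_bound[OF assms(1) e n(1) _ hi pq(3)] scale[OF n(3)] n(2)
    by (auto simp: gap_ends_def)
  show "thickness K * \<eta> \<le> q - p"
  proof (cases "\<exists>y\<in>K. q < y")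
    case True
    then obtain b where b: "(q, b) \<in> gap_ends K" "\<eta> \<le> b - q"
      using gap_starting_at[OF assms(1) pq(2) _ _ \<eta> eq] by blast
    then obtain n where n: "e n = {q<..<b}" using en by blast
    have qb: "q < b" using b(1) by (simp add: gap_ends_def)
    show ?thesis
    proof (cases "\<exists>y\<in>K. y < p")
      case True
      then obtain c where c: "(c, p) \<in> gap_ends K" "\<eta> \<le> p - c"
        using gap_ending_at[OF assms(1) pq(1) _ _ \<eta> ep] by blast
      then obtain m where m: "e m = {c<..<p}" using en by blast
      have cp: "c < p" using c(1) by (simp add: gap_ends_def)
      have "m \<noteq> n" using m n cp qb pq(3) by (auto simp: greaterThanLessThan_eq_iff)
      then consider "m < n" | "n < m" by linarith
      then show ?thesis
      proof cases
        case 1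
        have "p \<le> x" if "x \<in> left_bridge K e n" for x
        proof (rule ccontr)
          assume "\<not> p \<le> x"
          then obtain z where "max x c < z" "z < p" using cp dense[of "max x c" p] by auto
          then have "z \<in> {x..q} \<inter> e m" using m pq(3) by auto
          then show False using that 1 left_bridge_eq[OF assms(1) e n qb] by blast
        qed
        then show ?thesis using left[OF n b] by blast
      next
        case 2
        have "x \<le> q" if "x \<in> right_bridge K e m" for x
        proof (rule ccontr)
          assume "\<not> x \<le> q"
          then obtain z where "q < z" "z < min x b" using qb dense[of q "min x b"] by auto
          then have "z \<in> {p..x} \<inter> e n" using n pq(3) by auto
          then show False using that 2 right_bridge_eq[OF assms(1) e m cp] by blast
        qed
        then show ?thesis using right[OF m c] by blast
      qed
    next
      case False
      then have "K \<subseteq> {p..}" by force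
      then have "convex hull K \<subseteq> {p..}" by (intro hull_minimal) auto
      then have "p \<le> x" if "x \<in> left_bridge K e n" for x
        using that left_bridge_eq[OF assms(1) e n qb] by auto
      then show ?thesis using left[OF n b] by blast
    qed
  next
    case False
    then have "K \<subseteq> {..q}" by force
    then have hull: "convex hull K \<subseteq> {..q}" by (intro hull_minimal) auto
    obtain y where "y \<in> K" "y < p" using nsub False by force
    then obtain c where c: "(c, p) \<in> gap_ends K" "\<eta> \<le> p - c"
      using gap_ending_at[OF assms(1) pq(1) _ _ \<eta> ep] by blast
    then obtain m where m: "e m = {c<..<p}" using en by blast
    have cp: "c < p" using c(1) by (simp add: gap_ends_def)
    have "x \<le> q" if "x \<in> right_bridge K e m" for x
      using that right_bridge_eq[OF assms(1) e m cp] hull by auto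
    then show ?thesis using right[OF m c] by blast
  qed
qed

section \<open>Pieces\<close>

text \<open>The intervals that remain when gaps are removed in order of decreasing length, at the moment when
  the gaps longer than \<open>\<eta>\<close> are gone: \<open>\<eta>\<close> separates the gaps already removed, next to the two ends, from
  those still inside.\<close>
definition piece :: "real set \<Rightarrow> real \<Rightarrow> real \<Rightarrow> real \<Rightarrow> real \<Rightarrow> bool" where
  "piece K t \<eta> p q \<longleftrightarrow> p \<in> K \<and> q \<in> K \<and> p \<le> q \<and>
     {p - \<eta><..<p} \<inter> K = {} \<and> {q<..<q + \<eta>} \<inter> K = {} \<and> t * \<eta> \<le> q - p \<and>
     (\<forall>(a, b)\<in>gap_ends K. p \<le> a \<longrightarrow> b \<le> q \<longrightarrow> b - a \<le> \<eta>)"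

lemma piece_shrink:
  assumes "piece K t \<eta> p q" "\<eta>' \<le> \<eta>" "0 \<le> t"
    and "\<And>a b. (a, b) \<in> gap_ends K \<Longrightarrow> p \<le> a \<Longrightarrow> b \<le> q \<Longrightarrow> b - a \<le> \<eta>'"
  shows "piece K t \<eta>' p q"
proof -
  have "{p - \<eta>'<..<p} \<subseteq> {p - \<eta><..<p}" "{q<..<q + \<eta>'} \<subseteq> {q<..<q + \<eta>}"
    using assms(2) by auto
  moreover have "t * \<eta>' \<le> t * \<eta>" using assms(2,3) by (intro mult_left_mono)
  ultimately show ?thesis using assms(1,4) unfolding piece_def by force
qed

text \<open>The cut creates new ends next to a gap of length exactly \<open>b - a\<close>, so both halves satisfy the
  condition on ends at this scale, and thickness makes them long enough. That the other side of the
  gap contains a point of \<open>K\<close> keeps the halves clear of the exceptional case in \<open>thick\<close>.\<close>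
lemma piece_split:
  assumes "thick K t" "piece K t (b - a) p q" "(a, b) \<in> gap_ends K" "p \<le> a" "b \<le> q"
  shows "piece K t (b - a) p a" "piece K t (b - a) b q"
proof -
  have ab: "a < b" "a \<in> K" "b \<in> K" "{a<..<b} \<inter> K = {}" using assms(3) by (auto simp: gap_ends_def)
  have P: "p \<in> K" "q \<in> K" "{p - (b - a)<..<p} \<inter> K = {}" "{q<..<q + (b - a)} \<inter> K = {}"
    "\<forall>(c, d)\<in>gap_ends K. p \<le> c \<longrightarrow> d \<le> q \<longrightarrow> d - c \<le> b - a"
    using assms(2) by (auto simp: piece_def)
  have "\<not> K \<subseteq> {p..a}" "\<not> K \<subseteq> {b..q}" using ab by auto
  then have "t * (b - a) \<le> a - p" "t * (b - a) \<le> q - b"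
    using assms(1,4,5) ab P unfolding thick_def by auto
  then show "piece K t (b - a) p a" "piece K t (b - a) b q"
    using ab P assms(4,5) unfolding piece_def by auto
qed

section \<open>Sums of pieces\<close>

lemma near_point_of_piece:
  assumes "compact K" "p \<in> K" "q \<in> K" "y \<in> {p..q}"
    and "\<And>a b. (a, b) \<in> gap_ends K \<Longrightarrow> p \<le> a \<Longrightarrow> b \<le> q \<Longrightarrow> b - a \<le> \<delta>" "0 \<le> \<delta>"
  shows "\<exists>x\<in>K \<inter> {p..q}. \<bar>x - y\<bar> \<le> \<delta>"
proof (cases "y \<in> K")
  case True
  then show ?thesis using assms by (intro bexI[of _ y]) auto
next
  case False
  have "compact (K \<inter> {p..y})" "K \<inter> {p..y} \<noteq> {}" "compact (K \<inter> {y..q})" "K \<inter> {y..q} \<noteq> {}"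
    using assms by (auto simp: compact_Int)
  then obtain a b where a: "a \<in> K \<inter> {p..y}" "\<And>z. z \<in> K \<inter> {p..y} \<Longrightarrow> z \<le> a"
    and b: "b \<in> K \<inter> {y..q}" "\<And>z. z \<in> K \<inter> {y..q} \<Longrightarrow> b \<le> z"
    using compact_attains_sup[of "K \<inter> {p..y}"] compact_attains_inf[of "K \<inter> {y..q}"] by metis
  have ay: "a < y" "y < b" using a(1) b(1) False by (auto simp: less_le)
  have "z \<notin> K" if "a < z" "z < b" for z
    using that a b by (cases "z \<le> y") force+
  then have "(a, b) \<in> gap_ends K" using ay a(1) b(1) by (auto simp: gap_ends_def)
  then have "b - a \<le> \<delta>" using assms(5) a(1) b(1) by auto
  then show ?thesis using a(1) ay assms(4) by (intro bexI[of _ a]) auto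
qed

lemma point_of_sum_interval:
  fixes p q :: "'i \<Rightarrow> real"
  assumes "finite I" "\<And>i. i \<in> I \<Longrightarrow> p i \<le> q i" "sum p I \<le> t" "t \<le> sum q I"
  obtains y where "\<And>i. i \<in> I \<Longrightarrow> y i \<in> {p i..q i}" "sum y I = t"
proof -
  have "\<exists>c\<ge>0. c \<le> 1 \<and> (\<Sum>i\<in>I. p i + c * (q i - p i)) = t"
    using assms(3,4) by (intro IVT) (auto intro!: continuous_intros)
  then obtain c where c: "0 \<le> c" "c \<le> 1" "(\<Sum>i\<in>I. p i + c * (q i - p i)) = t" by blast
  have "p i + c * (q i - p i) \<in> {p i..q i}" if "i \<in> I" for i
    using c assms(2)[OF that] mult_left_le_one_le[of "q i - p i" c] by auto
  then show ?thesis using that[of "\<lambda>i. p i + c * (q i - p i)"] c(3) by blast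
qed

lemma sum_fun_upd_remove:
  fixes f :: "'i \<Rightarrow> real"
  assumes "finite I" "k \<in> I"
  shows "sum (f(k := c)) I = c + sum f (I - {k})"
proof -
  have "sum (f(k := c)) (I - {k}) = sum f (I - {k})" by (rule sum.cong) auto
  then show ?thesis using assms by (simp add: sum.remove[of I k] del: fun_upd_apply) simp
qed

text \<open>The descent: the gap of largest weighted length is removed and the half that keeps \<open>t\<close> within reach
  is retained. It terminates since the number of remaining gaps of weighted length at least \<open>\<delta>\<close>
  drops; when none is left, all gaps are shorter than \<open>\<delta>\<close>, and any way of writing \<open>t\<close> as a sum of points of
  the remaining intervals can be moved into the sets at a cost of \<open>\<delta>\<close> per summand.\<close>
lemma approx_sum_of_pieces:
  fixes K :: "'i \<Rightarrow> real set" and \<tau> p q :: "'i \<Rightarrow> real" and \<delta> :: real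
  assumes "finite I" "\<And>i. i \<in> I \<Longrightarrow> compact (K i)" "\<And>i. i \<in> I \<Longrightarrow> thick (K i) (\<tau> i)"
    and \<tau>: "\<And>i. i \<in> I \<Longrightarrow> 0 \<le> \<tau> i" and "1 \<le> (\<Sum>i\<in>I. \<tau> i / (\<tau> i + 1))" and "0 < \<delta>"
    and "\<And>i. i \<in> I \<Longrightarrow> piece (K i) (\<tau> i) (H / (\<tau> i + 1)) (p i) (q i)"
    and "sum p I \<le> t" "t \<le> sum q I"
  shows "\<exists>x. (\<forall>i\<in>I. x i \<in> K i \<inter> {p i..q i}) \<and> \<bar>sum x I - t\<bar> \<le> card I * \<delta>"
  using assms(7-9)
proof (induction "card {(i, a, b). i \<in> I \<and> (a, b) \<in> gap_ends (K i) \<and> p i \<le> a \<and> b \<le> q i \<and>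
      \<delta> \<le> (\<tau> i + 1) * (b - a)}" arbitrary: H p q rule: less_induct)
  case less
  define G where "G p q = {(i, a, b). i \<in> I \<and> (a, b) \<in> gap_ends (K i) \<and> p i \<le> a \<and> b \<le> q i \<and>
      \<delta> \<le> (\<tau> i + 1) * (b - a)}" for p q
  have finG: "finite (G p q)" for p q
  proof (rule finite_subset)
    show "G p q \<subseteq> (SIGMA i:I. {(a, b) \<in> gap_ends (K i). \<delta> / (\<tau> i + 1) \<le> b - a})"
      using \<tau> by (force simp: G_def pos_divide_le_eq add_nonneg_pos mult.commute)
    show "finite (SIGMA i:I. {(a, b) \<in> gap_ends (K i). \<delta> / (\<tau> i + 1) \<le> b - a})"
      using assms(1,2,6) \<tau> by (intro finite_SigmaI finite_long_gap_ends) (auto simp: add_nonneg_pos)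
  qed
  have P: "p i \<in> K i" "q i \<in> K i" "p i \<le> q i" if "i \<in> I" for i
    using less.prems(1)[OF that] by (auto simp: piece_def)
  show ?case
  proof (cases "G p q = {}")
    case True
    obtain y where y: "\<And>i. i \<in> I \<Longrightarrow> y i \<in> {p i..q i}" "sum y I = t"
      using point_of_sum_interval[OF assms(1) P(3) less.prems(2,3)] by blast
    have "\<exists>x\<in>K i \<inter> {p i..q i}. \<bar>x - y i\<bar> \<le> \<delta>" if i: "i \<in> I" for i
    proof (intro near_point_of_piece assms(2) P y i)
      fix a b assume ab: "(a, b) \<in> gap_ends (K i)" "p i \<le> a" "b \<le> q i"
      then have "(\<tau> i + 1) * (b - a) < \<delta>" using True i by (force simp: G_def)
      moreover have "0 \<le> \<tau> i * (b - a)" using \<tau>[OF i] ab(1) by (auto simp: gap_ends_def)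
      ultimately show "b - a \<le> \<delta>" by (simp add: algebra_simps)
    qed (use assms(6) in auto)
    then obtain x where x: "\<And>i. i \<in> I \<Longrightarrow> x i \<in> K i \<inter> {p i..q i} \<and> \<bar>x i - y i\<bar> \<le> \<delta>"
      by metis
    have "\<bar>sum x I - t\<bar> \<le> (\<Sum>i\<in>I. \<bar>x i - y i\<bar>)"
      unfolding y(2)[symmetric] sum_subtractf[symmetric] by (rule sum_abs)
    also have "\<dots> \<le> card I * \<delta>" using x by (intro sum_bounded_above) auto
    finally show ?thesis using x by blast
  next
    case False
    then obtain g where g: "g \<in> G p q" and "\<forall>h\<in>G p q.
        (case h of (i, a, b) \<Rightarrow> (\<tau> i + 1) * (b - a)) \<le> (case g of (i, a, b) \<Rightarrow> (\<tau> i + 1) * (b - a))"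
      using finite_has_argmax[OF finG] by blast
    moreover obtain k a b where [simp]: "g = (k, a, b)" by (metis prod_cases3)
    ultimately have k: "k \<in> I" "(a, b) \<in> gap_ends (K k)" "p k \<le> a" "b \<le> q k" "\<delta> \<le> (\<tau> k + 1) * (b - a)"
      and max: "\<And>i c d. (i, c, d) \<in> G p q \<Longrightarrow> (\<tau> i + 1) * (d - c) \<le> (\<tau> k + 1) * (b - a)"
      by (auto simp: G_def)
    have ab: "a < b" using k(2) by (simp add: gap_ends_def)
    \<comment> \<open>the new scale: all gaps still present have weighted length at most \<open>H'\<close>\<close>
    define H' where "H' = (\<tau> k + 1) * (b - a)"
    have \<tau>1: "0 < \<tau> i + 1" if "i \<in> I" for i using \<tau>[OF that] by simp
    have H'k: "H' / (\<tau> k + 1) = b - a" using \<tau>1[OF k(1)] by (simp add: H'_def)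
    have "b - a \<le> H / (\<tau> k + 1)" using less.prems(1)[OF k(1)] k unfolding piece_def by blast
    then have H': "H' \<le> H" "0 < H'"
      using \<tau>1[OF k(1)] ab by (simp_all add: H'_def pos_le_divide_eq mult.commute)
    have pc: "piece (K i) (\<tau> i) (H' / (\<tau> i + 1)) (p i) (q i)" if i: "i \<in> I" for i
    proof (rule piece_shrink[OF less.prems(1)[OF i] _ \<tau>[OF i]])
      show "H' / (\<tau> i + 1) \<le> H / (\<tau> i + 1)" using H' \<tau>1[OF i] by (simp add: divide_right_mono)
      fix c d assume cd: "(c, d) \<in> gap_ends (K i)" "p i \<le> c" "d \<le> q i"
      have "(\<tau> i + 1) * (d - c) \<le> H'"
      proof (cases "\<delta> \<le> (\<tau> i + 1) * (d - c)")
        case True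
        then show ?thesis unfolding H'_def using max cd i by (auto simp: G_def)
      next
        case False
        then show ?thesis using k(5) by (simp add: H'_def)
      qed
      then show "d - c \<le> H' / (\<tau> i + 1)" using \<tau>1[OF i] by (simp add: pos_le_divide_eq mult.commute)
    qed
    have "piece (K k) (\<tau> k) (b - a) (p k) (q k)" using pc[OF k(1)] H'k by simp
    note split = piece_split[OF assms(3)[OF k(1)] this k(2-4)]
    have descend: ?thesis
      if pc': "\<And>i. i \<in> I \<Longrightarrow> piece (K i) (\<tau> i) (H' / (\<tau> i + 1)) (p' i) (q' i)"
        and t': "sum p' I \<le> t" "t \<le> sum q' I"
        and sub: "\<And>i. i \<in> I \<Longrightarrow> p i \<le> p' i \<and> q' i \<le> q i" and g': "g \<notin> G p' q'" for p' q'
    proof -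
      have "G p' q' \<subseteq> G p q" using sub by (force simp: G_def)
      then have "G p' q' \<subset> G p q" using g g' by blast
      then have "card (G p' q') < card (G p q)" using finG psubset_card_mono by blast
      then obtain x where "\<forall>i\<in>I. x i \<in> K i \<inter> {p' i..q' i}" "\<bar>sum x I - t\<bar> \<le> card I * \<delta>"
        using less.hyps[of p' q' H', folded G_def, OF _ pc' t'] by blast
      then show ?thesis using sub by (intro exI[of _ x]) force
    qed
    \<comment> \<open>the hypothesis on the sum of the \<open>\<gamma>\<^sub>i\<close> enters here: the other pieces together bridge the gap\<close>
    have gap_le: "b - a \<le> sum q (I - {k}) - sum p (I - {k})"
    proof -
      have "b - a = H' * (1 - \<tau> k / (\<tau> k + 1))"
        using \<tau>1[OF k(1)] by (simp add: H'_def field_simps)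
      also have "\<dots> \<le> H' * (\<Sum>i\<in>I - {k}. \<tau> i / (\<tau> i + 1))"
        using assms(5) H'(2) by (intro mult_left_mono) (simp_all add: sum.remove[OF assms(1) k(1)])
      also have "\<dots> = (\<Sum>i\<in>I - {k}. \<tau> i * (H' / (\<tau> i + 1)))"
        by (simp add: sum_distrib_left mult.commute)
      also have "\<dots> \<le> (\<Sum>i\<in>I - {k}. q i - p i)"
        using pc by (intro sum_mono) (auto simp: piece_def)
      finally show ?thesis by (simp add: sum_subtractf)
    qed
    show ?thesis
    proof (cases "t \<le> a + sum q (I - {k})")
      case True
      show ?thesis
      proof (rule descend)
        show "piece (K i) (\<tau> i) (H' / (\<tau> i + 1)) (p i) ((q(k := a)) i)" if "i \<in> I" for i
          using pc[OF that] split(1) H'k by simp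
        show "t \<le> sum (q(k := a)) I"
          using True by (simp only: sum_fun_upd_remove[OF assms(1) k(1)])
      qed (use less.prems(2) k ab in \<open>auto simp: G_def\<close>)
    next
      case False
      show ?thesis
      proof (rule descend)
        show "piece (K i) (\<tau> i) (H' / (\<tau> i + 1)) ((p(k := b)) i) (q i)" if "i \<in> I" for i
          using pc[OF that] split(2) H'k by simp
        show "sum (p(k := b)) I \<le> t"
          unfolding sum_fun_upd_remove[OF assms(1) k(1)] using False gap_le by linarith
      qed (use less.prems(3) k ab in \<open>auto simp: G_def\<close>)
    qed
  qed
qed

lemma compact_finite_sumset:
  fixes K :: "'i \<Rightarrow> real set"
  assumes "finite I" "\<And>i. i \<in> I \<Longrightarrow> compact (K i)"
  shows "compact {sum x I | x. \<forall>i\<in>I. x i \<in> K i}"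
  using assms
proof (induction I)
  case empty
  then show ?case by simp
next
  case (insert k I)
  have "{sum x (insert k I) | x. \<forall>i\<in>insert k I. x i \<in> K i} =
      {u + v | u v. u \<in> K k \<and> v \<in> {sum x I | x. \<forall>i\<in>I. x i \<in> K i}}" (is "?L = ?R")
  proof (intro subset_antisym subsetI)
    fix s assume "s \<in> ?L"
    then show "s \<in> ?R" using insert.hyps by auto
  next
    fix s assume "s \<in> ?R"
    then obtain u x where "u \<in> K k" "\<forall>i\<in>I. x i \<in> K i" "s = u + sum x I" by auto
    moreover have "sum (x(k := u)) (insert k I) = u + sum x I"
      using insert.hyps sum_fun_upd_remove[of "insert k I" k x u] by simp
    ultimately show "s \<in> ?L"
      by (intro CollectI exI[of _ "x(k := u)"]) auto
  qed
  moreover have "compact ?R"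
    using insert by (intro compact_sums) auto
  ultimately show ?case by simp
qed

lemma sum_of_pieces_eq_interval:
  fixes K :: "'i \<Rightarrow> real set" and \<tau> p q :: "'i \<Rightarrow> real"
  assumes "finite I" "\<And>i. i \<in> I \<Longrightarrow> compact (K i)" "\<And>i. i \<in> I \<Longrightarrow> thick (K i) (\<tau> i)"
    and "\<And>i. i \<in> I \<Longrightarrow> 0 \<le> \<tau> i" "1 \<le> (\<Sum>i\<in>I. \<tau> i / (\<tau> i + 1))"
    and "\<And>i. i \<in> I \<Longrightarrow> piece (K i) (\<tau> i) (H / (\<tau> i + 1)) (p i) (q i)"
  shows "{sum x I | x. \<forall>i\<in>I. x i \<in> K i \<inter> {p i..q i}} = {sum p I..sum q I}" (is "?S = _")
proof (intro subset_antisym subsetI)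
  fix s assume "s \<in> ?S"
  then show "s \<in> {sum p I..sum q I}" by (auto intro!: sum_mono)
next
  fix t assume t: "t \<in> {sum p I..sum q I}"
  have "closed ?S"
    using assms(1,2) by (intro compact_imp_closed compact_finite_sumset) (auto simp: compact_Int)
  moreover have "t \<in> closure ?S"
    unfolding closure_approachable
  proof (intro allI impI)
    fix r :: real assume r: "0 < r"
    define \<delta> where "\<delta> = r / (card I + 1)"
    have "0 < \<delta>" using r by (simp add: \<delta>_def add_nonneg_pos)
    then obtain x where x: "\<forall>i\<in>I. x i \<in> K i \<inter> {p i..q i}" "\<bar>sum x I - t\<bar> \<le> card I * \<delta>"
      using approx_sum_of_pieces[OF assms(1-5) _ assms(6), of \<delta>] t by fastforce
    have "card I * \<delta> < (card I + 1) * \<delta>" using \<open>0 < \<delta>\<close> by simp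
    also have "\<dots> = r" by (simp add: \<delta>_def)
    finally have "dist (sum x I) t < r" using x(2) by (simp add: dist_real_def)
    then show "\<exists>y\<in>?S. dist y t < r" using x(1) by blast
  qed
  ultimately show "t \<in> ?S" by (simp only: closure_closed)
qed

section \<open>Cutting a set into finitely many pieces\<close>

lemma finite_isolated_ends:
  fixes K :: "real set"
  assumes "compact K" "0 < \<eta>"
  shows "finite {p \<in> K. {p - \<eta><..<p} \<inter> K = {}}" "finite {q \<in> K. {q<..<q + \<eta>} \<inter> K = {}}"
proof -
  define G where "G = {(a, b) \<in> gap_ends K. \<eta> \<le> b - a}"
  have finG: "finite G" unfolding G_def by (rule finite_long_gap_ends[OF assms])
  have "p \<in> insert (Inf K) (snd ` G)" if p: "p \<in> K" "{p - \<eta><..<p} \<inter> K = {}" for p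
  proof (cases "\<exists>y\<in>K. y < p")
    case True
    then obtain c where "(c, p) \<in> G"
      using gap_ending_at[OF assms(1) p(1) _ _ assms(2) p(2)] by (auto simp: G_def)
    then show ?thesis by force
  next
    case False
    then have "Inf K = p" using p(1) by (intro cInf_eq_minimum) (auto simp: not_less)
    then show ?thesis by simp
  qed
  then have "{p \<in> K. {p - \<eta><..<p} \<inter> K = {}} \<subseteq> insert (Inf K) (snd ` G)" by blast
  then show "finite {p \<in> K. {p - \<eta><..<p} \<inter> K = {}}"
    using finG by (meson finite_imageI finite_insert finite_subset)
  have "q \<in> insert (Sup K) (fst ` G)" if q: "q \<in> K" "{q<..<q + \<eta>} \<inter> K = {}" for q
  proof (cases "\<exists>y\<in>K. q < y")
    case True
    then obtain b where "(q, b) \<in> G"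
      using gap_starting_at[OF assms(1) q(1) _ _ assms(2) q(2)] by (auto simp: G_def)
    then show ?thesis by force
  next
    case False
    then have "Sup K = q" using q(1) by (intro cSup_eq_maximum) (auto simp: not_less)
    then show ?thesis by simp
  qed
  then have "{q \<in> K. {q<..<q + \<eta>} \<inter> K = {}} \<subseteq> insert (Sup K) (fst ` G)" by blast
  then show "finite {q \<in> K. {q<..<q + \<eta>} \<inter> K = {}}"
    using finG by (meson finite_imageI finite_insert finite_subset)
qed

lemma finite_pieces:
  assumes "compact K" "0 < \<eta>"
  shows "finite {(p, q). piece K t \<eta> p q}"
proof (rule finite_subset)
  show "{(p, q). piece K t \<eta> p q} \<subseteq>
      {p \<in> K. {p - \<eta><..<p} \<inter> K = {}} \<times> {q \<in> K. {q<..<q + \<eta>} \<inter> K = {}}"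
    by (auto simp only: piece_def)
qed (intro finite_cartesian_product finite_isolated_ends[OF assms])

text \<open>The piece around \<open>x\<close> is bounded by the nearest ends of long gaps, or of \<open>K\<close>, on either side. A long gap
  inside would have an end nearer to \<open>x\<close>. Thickness yields the required length except when the piece
  is all of \<open>K\<close>, and for this case the length is a hypothesis.\<close>
lemma piece_containing:
  assumes "compact K" "thick K t" "0 < \<eta>" "x \<in> K"
    and long: "\<And>p q. K \<subseteq> {p..q} \<Longrightarrow> t * \<eta> \<le> q - p"
  obtains p q where "piece K t \<eta> p q" "x \<in> {p..q}"
proof -
  define P where "P = {p \<in> K. {p - \<eta><..<p} \<inter> K = {}} \<inter> {..x}"
  define Q where "Q = {q \<in> K. {q<..<q + \<eta>} \<inter> K = {}} \<inter> {x..}"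
  have fin: "finite P" "finite Q"
    unfolding P_def Q_def using finite_isolated_ends[OF assms(1,3)] by blast+
  have "K \<noteq> {}" using assms(4) by blast
  then obtain A B where A: "A \<in> K" "\<And>y. y \<in> K \<Longrightarrow> A \<le> y" and B: "B \<in> K" "\<And>y. y \<in> K \<Longrightarrow> y \<le> B"
    using compact_attains_inf[OF assms(1)] compact_attains_sup[OF assms(1)] by metis
  have "A \<in> P" "B \<in> Q" using A B assms(4) by (force simp: P_def Q_def)+
  then have ne: "P \<noteq> {}" "Q \<noteq> {}" by auto
  define p q where "p = Max P" and "q = Min Q"
  have p: "p \<in> P" "\<And>z. z \<in> P \<Longrightarrow> z \<le> p" and q: "q \<in> Q" "\<And>z. z \<in> Q \<Longrightarrow> q \<le> z"
    unfolding p_def q_def using fin ne by auto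
  have px: "p \<in> K" "p \<le> x" "{p - \<eta><..<p} \<inter> K = {}" and qx: "q \<in> K" "x \<le> q" "{q<..<q + \<eta>} \<inter> K = {}"
    using p(1) q(1) by (auto simp: P_def Q_def)
  have len: "t * \<eta> \<le> q - p"
  proof (cases "K \<subseteq> {p..q}")
    case False
    moreover have "p \<le> q" using px qx by linarith
    ultimately show ?thesis using assms(2,3) px qx unfolding thick_def by blast
  qed (rule long)
  have gap: "b - a \<le> \<eta>" if ab: "(a, b) \<in> gap_ends K" "p \<le> a" "b \<le> q" for a b
  proof (rule ccontr)
    assume "\<not> b - a \<le> \<eta>"
    then have sub: "{b - \<eta><..<b} \<subseteq> {a<..<b}" "{a<..<a + \<eta>} \<subseteq> {a<..<b}" by auto
    have g: "a < b" "a \<in> K" "b \<in> K" "{a<..<b} \<inter> K = {}" using ab(1) by (auto simp: gap_ends_def)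
    then consider "x \<le> a" | "b \<le> x" using assms(4) by (meson disjoint_iff greaterThanLessThan_iff not_le)
    then show False
    proof cases
      case 1
      then have "a \<in> Q" using g sub(2) by (auto simp: Q_def)
      then show False using q(2) ab(3) g(1) by force
    next
      case 2
      then have "b \<in> P" using g sub(1) by (auto simp: P_def)
      then show False using p(2) ab(2) g(1) by force
    qed
  qed
  have "piece K t \<eta> p q"
    unfolding piece_def using px qx len gap by auto
  then show ?thesis using that px qx by simp
qed

section \<open>Sums of thick compact sets\<close>

theorem corollary1p16:
  fixes d :: nat and K :: "nat \<Rightarrow> real set" and A B :: "nat \<Rightarrow> real"
  assumes "2 \<le> d"
    and "\<And>i. i \<in> {1..d} \<Longrightarrow> compact (K i)"
    and "\<And>i. i \<in> {1..d} \<Longrightarrow> convex hull (K i) = {A i..B i}"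
    and "\<And>i. i \<in> {1..d} \<Longrightarrow> infinite (gaps (K i))"
    and "\<And>i x. i \<in> {1..d} \<Longrightarrow> x \<in> K i \<Longrightarrow> x islimpt K i"
    and "(\<Sum>i=1..d. thickness (K i) / (thickness (K i) + 1)) \<ge> 1"
  shows "\<exists>F :: real set set. finite F \<and> (\<forall>J\<in>F. \<exists>a b. a < b \<and> J = {a..b}) \<and>
           {\<Sum>i=1..d. x i | x. \<forall>i\<in>{1..d}. x i \<in> K i} = \<Union>F"
proof -
  define \<tau> where "\<tau> i = thickness (K i)" for i
  have \<tau>: "0 \<le> \<tau> i" "0 < \<tau> i + 1" for i
    using thickness_nonneg[of "K i"] by (simp_all add: \<tau>_def)
  have thick: "thick (K i) (\<tau> i)" if "i \<in> {1..d}" for i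
    unfolding \<tau>_def using thick_thickness assms(2,4) that by blast
  have AB: "A i < B i" if i: "i \<in> {1..d}" for i
  proof -
    obtain U where "U \<in> gaps (K i)" using assms(4)[OF i] by (metis all_not_in_conv finite.emptyI)
    then obtain a b where "a < b" "a \<in> K i" "b \<in> K i" using gap_interval[OF assms(2)[OF i]] by metis
    moreover have "K i \<subseteq> {A i..B i}" using hull_subset[of "K i" convex] assms(3)[OF i] by simp
    ultimately have "A i \<le> a" "b \<le> B i" by auto
    then show ?thesis using \<open>a < b\<close> by linarith
  qed
  \<comment> \<open>the common scale; at most the length of each hull, so that an undivided \<open>K i\<close> is a piece too\<close>
  define \<epsilon> where "\<epsilon> = Min ((\<lambda>i. B i - A i) ` {1..d})"
  have "{1..d} \<noteq> {}" using assms(1) by simp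
  then have \<epsilon>: "0 < \<epsilon>" "\<And>i. i \<in> {1..d} \<Longrightarrow> \<epsilon> \<le> B i - A i"
    using AB by (auto simp: \<epsilon>_def)
  define \<eta> where "\<eta> i = \<epsilon> / (\<tau> i + 1)" for i
  have \<eta>: "0 < \<eta> i" "\<tau> i * \<eta> i \<le> \<epsilon>" for i
    using \<tau>[of i] \<epsilon>(1) by (simp_all add: \<eta>_def field_simps)
  \<comment> \<open>\<open>T\<close> consists of the choices of one piece in each set\<close>
  define T where "T = (\<Pi>\<^sub>E i\<in>{1..d}. {(p, q). piece (K i) (\<tau> i) (\<eta> i) p q})"
  define J where "J f = {(\<Sum>i=1..d. fst (f i))..(\<Sum>i=1..d. snd (f i))}" for f :: "nat \<Rightarrow> real \<times> real"
  have finT: "finite T"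
    unfolding T_def using assms(2) \<eta>(1) by (intro finite_PiE finite_pieces) auto
  have pc: "piece (K i) (\<tau> i) (\<epsilon> / (\<tau> i + 1)) (fst (f i)) (snd (f i))" if "f \<in> T" "i \<in> {1..d}" for f i
    using PiE_mem[OF that[unfolded T_def]] unfolding \<eta>_def by (simp add: split_beta)
  have J: "{\<Sum>i=1..d. x i | x. \<forall>i\<in>{1..d}. x i \<in> K i \<inter> {fst (f i)..snd (f i)}} = J f" if "f \<in> T" for f
    unfolding J_def
    by (rule sum_of_pieces_eq_interval[where H = \<epsilon>])
       (use assms(2,6) thick \<tau> pc that in \<open>auto simp: \<tau>_def\<close>)
  have nondeg: "(\<Sum>i=1..d. fst (f i)) < (\<Sum>i=1..d. snd (f i))" if "f \<in> T" for f
  proof -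
    have "0 < \<epsilon> * (\<Sum>i=1..d. \<tau> i / (\<tau> i + 1))" using \<epsilon>(1) assms(6) by (simp add: \<tau>_def)
    also have "\<dots> = (\<Sum>i=1..d. \<tau> i * (\<epsilon> / (\<tau> i + 1)))"
      by (simp add: sum_distrib_left mult.commute)
    also have "\<dots> \<le> (\<Sum>i=1..d. snd (f i) - fst (f i))"
      using pc[OF that] by (intro sum_mono) (auto simp: piece_def)
    finally show ?thesis by (simp add: sum_subtractf)
  qed
  have cover: "\<exists>f\<in>T. \<forall>i\<in>{1..d}. x i \<in> {fst (f i)..snd (f i)}" if x: "\<forall>i\<in>{1..d}. x i \<in> K i" for x
  proof -
    have "\<exists>pq. piece (K i) (\<tau> i) (\<eta> i) (fst pq) (snd pq) \<and> x i \<in> {fst pq..snd pq}"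
      if i: "i \<in> {1..d}" for i
    proof -
      have long: "\<tau> i * \<eta> i \<le> q - p" if "K i \<subseteq> {p..q}" for p q
      proof -
        have "{A i..B i} \<subseteq> {p..q}" using hull_minimal[OF that, of convex] assms(3)[OF i] by simp
        then show ?thesis using AB[OF i] \<epsilon>(2)[OF i] \<eta>(2)[of i] by auto
      qed
      obtain p q where "piece (K i) (\<tau> i) (\<eta> i) p q" "x i \<in> {p..q}"
        using piece_containing[OF assms(2)[OF i] thick[OF i] \<eta>(1) _ long] x i by metis
      then show ?thesis by (intro exI[of _ "(p, q)"]) simp
    qed
    then obtain f where "\<And>i. i \<in> {1..d} \<Longrightarrow>
        piece (K i) (\<tau> i) (\<eta> i) (fst (f i)) (snd (f i)) \<and> x i \<in> {fst (f i)..snd (f i)}" by metis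
    then show ?thesis
      by (intro bexI[of _ "restrict f {1..d}"]) (auto simp: T_def split_beta)
  qed
  show ?thesis
  proof (intro exI[of _ "J ` T"] conjI)
    show "finite (J ` T)" using finT by simp
    show "\<forall>L\<in>J ` T. \<exists>a b. a < b \<and> L = {a..b}" using nondeg J_def by blast
    show "{\<Sum>i=1..d. x i | x. \<forall>i\<in>{1..d}. x i \<in> K i} = \<Union>(J ` T)"
    proof (intro subset_antisym subsetI)
      fix s assume "s \<in> {\<Sum>i=1..d. x i | x. \<forall>i\<in>{1..d}. x i \<in> K i}"
      then obtain x where x: "s = (\<Sum>i=1..d. x i)" "\<forall>i\<in>{1..d}. x i \<in> K i" by blast
      obtain f where f: "f \<in> T" "\<forall>i\<in>{1..d}. x i \<in> {fst (f i)..snd (f i)}"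
        using cover[OF x(2)] by blast
      then have "s \<in> J f"
        unfolding J[OF f(1), symmetric] mem_Collect_eq using x by (intro exI[of _ x]) simp
      then show "s \<in> \<Union>(J ` T)" using f(1) by blast
    next
      fix s assume "s \<in> \<Union>(J ` T)"
      then obtain f where f: "f \<in> T" "s \<in> J f" by blast
      then obtain x where "s = (\<Sum>i=1..d. x i)" "\<forall>i\<in>{1..d}. x i \<in> K i \<inter> {fst (f i)..snd (f i)}"
        unfolding J[OF f(1), symmetric] by blast
      then show "s \<in> {\<Sum>i=1..d. x i | x. \<forall>i\<in>{1..d}. x i \<in> K i}" by blast
    qed
  qed
qed

end
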